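(* Let $F$ be a free filter on $\omega$ such that $F\le_K\mathcal{Z}^*$. If $K$ is a compact Hausdorff space such that $N_F$ homeomorphically embeds into $K$, then the Banach space $C(K)$ is not a Grothendieck space.
   Context: A filter $F$ on $\omega$ is free if $\bigcap F=\emptyset$ (equivalently, $F$ contains every cofinite set); filters are proper. For free filters $F,G$ on $\omega$, $F\le_K G$ means there is $f:\omega\to\omega$ such that $f^{-1}[A]\in G$ for every $A\in F$. $\mathcal{Z}=\{A\subseteq\omega:\limsup_{n\to\infty}|A\cap[0,n)|/n=0\}$ is the asymptotic density ideal and $\mathcal{Z}^*=\{A\subseteq\omega:\omega\setminus A\in\mathcal{Z}\}$ its dual filter. For a free filter $F$ on $\omega$, $N_F=\omega\cup\{p_F\}$, $p_F\notin\omega$, with the topology in which every point of $\omega$ is isolated and the open neighborhoods of $p_F$ are exactly the sets $A\cup\{p_F\}$ with $A\in F$. $C(K)$ is the Banach space of continuous real-valued functions on $K$ with the supremum norm. A Banach space $E$ is Grothendieck if every weak* null sequence in the dual space $E^*$ is weakly null. *)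

theory Defs
  imports "HOL-Analysis.Analysis"
begin

text \<open>
  Filters on \<open>\<omega>\<close> are values of type \<^typ>\<open>nat filter\<close>. Membership of a set \<open>A\<close> in \<open>F\<close> is
  \<open>eventually (\<lambda>n. n \<in> A) F\<close>. The library's type also contains the improper
  filter \<^term>\<open>bot\<close>, which therefore has to be excluded explicitly.
\<close>

definition free_filter :: "nat filter \<Rightarrow> bool" where
  "free_filter F \<longleftrightarrow> F \<noteq> bot \<and> \<Inter>{A. eventually (\<lambda>n. n \<in> A) F} = {}"

definition katetov_le :: "nat filter \<Rightarrow> nat filter \<Rightarrow> bool" (infix \<open>\<le>\<^sub>K\<close> 50) where
  "F \<le>\<^sub>K G \<longleftrightarrow>
     (\<exists>f :: nat \<Rightarrow> nat. \<forall>A. eventually (\<lambda>n. n \<in> A) F \<longrightarrow> eventually (\<lambda>n. n \<in> f -` A) G)"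

lemma katetov_le_iff_filterlim: "F \<le>\<^sub>K G \<longleftrightarrow> (\<exists>f. filterlim f F G)"
proof -
  have "(\<forall>A. eventually (\<lambda>n. n \<in> A) F \<longrightarrow> eventually (\<lambda>n. n \<in> f -` A) G) \<longleftrightarrow> filterlim f F G"
    for f :: "nat \<Rightarrow> nat"
  proof
    assume *: "\<forall>A. eventually (\<lambda>n. n \<in> A) F \<longrightarrow> eventually (\<lambda>n. n \<in> f -` A) G"
    show "filterlim f F G"
      unfolding filterlim_iff using *[rule_format, of "Collect P" for P] by simp
  next
    assume "filterlim f F G"
    then show "\<forall>A. eventually (\<lambda>n. n \<in> A) F \<longrightarrow> eventually (\<lambda>n. n \<in> f -` A) G"
      unfolding filterlim_iff vimage_eq by (intro allI impI) (erule allE, erule mp)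
  qed
  then show ?thesis
    by (simp add: katetov_le_def)
qed

text \<open>
  The quotient is \<open>0\<close> at \<open>n = 0\<close> because \<open>x / 0 = 0\<close>. The limit superior is taken in
  \<^typ>\<open>ereal\<close>, where it always exists.
\<close>

definition density_ideal :: "nat set set" where
  "density_ideal = {A. limsup (\<lambda>n. ereal (real (card (A \<inter> {0..<n})) / real n)) = 0}"

lemma density_ideal_iff_tendsto:
  "A \<in> density_ideal \<longleftrightarrow> (\<lambda>n. real (card (A \<inter> {0..<n})) / real n) \<longlonglongrightarrow> 0"
proof -
  let ?d = "\<lambda>n. real (card (A \<inter> {0..<n})) / real n"
  have "limsup (\<lambda>n. ereal (?d n)) = 0 \<longleftrightarrow> (\<lambda>n. ereal (?d n)) \<longlonglongrightarrow> 0"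
  proof
    assume *: "limsup (\<lambda>n. ereal (?d n)) = 0"
    have "0 \<le> liminf (\<lambda>n. ereal (?d n))"
      by (rule Liminf_bounded) simp
    moreover have "liminf (\<lambda>n. ereal (?d n)) \<le> 0"
      using Liminf_le_Limsup[of sequentially "\<lambda>n. ereal (?d n)"] * by simp
    ultimately have "liminf (\<lambda>n. ereal (?d n)) = 0"
      by (rule antisym[rotated])
    with * show "(\<lambda>n. ereal (?d n)) \<longlonglongrightarrow> 0"
      by (simp add: tendsto_iff_Liminf_eq_Limsup)
  next
    assume "(\<lambda>n. ereal (?d n)) \<longlonglongrightarrow> 0"
    then show "limsup (\<lambda>n. ereal (?d n)) = 0"
      by (rule lim_imp_Limsup[rotated]) simp
  qed
  also have "\<dots> \<longleftrightarrow> ?d \<longlonglongrightarrow> 0"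
    by (simp add: zero_ereal_def)
  finally show ?thesis
    by (simp add: density_ideal_def)
qed

lemma finite_imp_density_ideal:
  assumes "finite A" shows "A \<in> density_ideal"
  unfolding density_ideal_iff_tendsto
proof (rule tendsto_sandwich[OF _ _ tendsto_const])
  show "(\<lambda>n. real (card A) / real n) \<longlonglongrightarrow> 0"
    by (rule lim_const_over_n)
  show "\<forall>\<^sub>F n in sequentially. real (card (A \<inter> {0..<n})) / real n \<le> real (card A) / real n"
    using assms by (intro always_eventually allI divide_right_mono) (auto intro: card_mono)
qed simp

lemma density_ideal_Un:
  assumes "A \<in> density_ideal" "B \<in> density_ideal" shows "A \<union> B \<in> density_ideal"
  unfolding density_ideal_iff_tendsto
proof (rule tendsto_sandwich[OF _ _ tendsto_const])
  show "(\<lambda>n. real (card (A \<inter> {0..<n})) / real n + real (card (B \<inter> {0..<n})) / real n) \<longlonglongrightarrow> 0"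
    using assms tendsto_add unfolding density_ideal_iff_tendsto by fastforce
  have "card ((A \<union> B) \<inter> {0..<n}) \<le> card (A \<inter> {0..<n}) + card (B \<inter> {0..<n})" for n
    by (simp add: Int_Un_distrib2 card_Un_le)
  then have "real (card ((A \<union> B) \<inter> {0..<n})) \<le> real (card (A \<inter> {0..<n})) + real (card (B \<inter> {0..<n}))"
    for n
    by (metis of_nat_add of_nat_mono)
  then show "\<forall>\<^sub>F n in sequentially. real (card ((A \<union> B) \<inter> {0..<n})) / real n
      \<le> real (card (A \<inter> {0..<n})) / real n + real (card (B \<inter> {0..<n})) / real n"
    unfolding add_divide_distrib[symmetric]
    by (intro always_eventually allI divide_right_mono) auto
qed simp

lemma density_ideal_subset:
  assumes "B \<in> density_ideal" "A \<subseteq> B" shows "A \<in> density_ideal"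
  unfolding density_ideal_iff_tendsto
proof (rule tendsto_sandwich[OF _ _ tendsto_const])
  show "(\<lambda>n. real (card (B \<inter> {0..<n})) / real n) \<longlonglongrightarrow> 0"
    using assms by (simp add: density_ideal_iff_tendsto)
  show "\<forall>\<^sub>F n in sequentially. real (card (A \<inter> {0..<n})) / real n \<le> real (card (B \<inter> {0..<n})) / real n"
    using assms by (intro always_eventually allI divide_right_mono) (auto intro!: card_mono)
qed simp

lemma UNIV_notin_density_ideal: "UNIV \<notin> density_ideal"
proof
  assume "UNIV \<in> density_ideal"
  then have "(\<lambda>n. real n / real n) \<longlonglongrightarrow> 0"
    by (simp add: density_ideal_iff_tendsto)
  moreover have "(\<lambda>n. real n / real n) \<longlonglongrightarrow> 1"
    by (rule tendsto_eventually) (use eventually_gt_at_top[of 0] in eventually_elim, simp)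
  ultimately show False
    using LIMSEQ_unique by fastforce
qed

definition density_filter :: "nat filter" where
  "density_filter = Abs_filter (\<lambda>P. - Collect P \<in> density_ideal)"

lemma eventually_density_filter:
  "eventually P density_filter \<longleftrightarrow> - Collect P \<in> density_ideal"
proof -
  have "is_filter (\<lambda>P. - Collect P \<in> density_ideal)"
  proof
    show "- {x. True} \<in> density_ideal"
      by (simp add: finite_imp_density_ideal)
  next
    fix P Q assume "- Collect P \<in> density_ideal" "- Collect Q \<in> density_ideal"
    from density_ideal_Un[OF this] show "- {x. P x \<and> Q x} \<in> density_ideal"
      by (simp add: Collect_conj_eq)
  next
    fix P Q :: "nat \<Rightarrow> bool"
    assume "\<forall>x. P x \<longrightarrow> Q x" "- Collect P \<in> density_ideal"
    then show "- Collect Q \<in> density_ideal"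
      by (auto elim: density_ideal_subset)
  qed
  then show ?thesis
    by (simp add: density_filter_def eventually_Abs_filter)
qed

lemma free_filter_density_filter: "free_filter density_filter"
proof -
  have "density_filter \<noteq> bot"
    using UNIV_notin_density_ideal
    by (simp add: trivial_limit_def eventually_density_filter Compl_eq_Diff_UNIV)
  moreover have "eventually (\<lambda>m. m \<in> - {n}) density_filter" for n
    unfolding eventually_density_filter Collect_mem_eq double_compl
    by (rule finite_imp_density_ideal) simp
  then have "\<Inter>{A. eventually (\<lambda>n. n \<in> A) density_filter} = {}"
    by blast
  ultimately show ?thesis
    by (simp add: free_filter_def)
qed

text \<open>
  The space \<open>N\<^sub>F\<close>: the natural number \<open>n\<close> is the point \<^term>\<open>Some n\<close>, and
  \<^term>\<open>None\<close> is the additional point \<open>p\<^sub>F\<close>.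
\<close>

definition filter_space :: "nat filter \<Rightarrow> nat option topology" where
  "filter_space F = topology (\<lambda>U. None \<in> U \<longrightarrow> eventually (\<lambda>n. n \<in> Some -` U) F)"

lemma openin_filter_space:
  "openin (filter_space F) U \<longleftrightarrow> (None \<in> U \<longrightarrow> eventually (\<lambda>n. n \<in> Some -` U) F)"
proof -
  have "istopology (\<lambda>U. None \<in> U \<longrightarrow> eventually (\<lambda>n. n \<in> Some -` U) F)"
    unfolding istopology_def
  proof (intro conjI allI impI)
    fix S T
    assume "None \<in> S \<longrightarrow> eventually (\<lambda>n. n \<in> Some -` S) F"
      "None \<in> T \<longrightarrow> eventually (\<lambda>n. n \<in> Some -` T) F" "None \<in> S \<inter> T"
    then show "eventually (\<lambda>n. n \<in> Some -` (S \<inter> T)) F"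
      by (simp add: eventually_conj)
  next
    fix \<K>
    assume "\<forall>K\<in>\<K>. None \<in> K \<longrightarrow> eventually (\<lambda>n. n \<in> Some -` K) F" "None \<in> \<Union>\<K>"
    then obtain K where "K \<in> \<K>" "eventually (\<lambda>n. n \<in> Some -` K) F"
      by blast
    then show "eventually (\<lambda>n. n \<in> Some -` \<Union>\<K>) F"
      by (auto elim!: eventually_mono)
  qed
  then show ?thesis
    by (simp add: filter_space_def)
qed

lemma topspace_filter_space: "topspace (filter_space F) = UNIV"
  by (rule antisym[OF subset_UNIV openin_subset]) (simp add: openin_filter_space)

lemma openin_filter_space_isolated: "openin (filter_space F) {Some n}"
  by (simp add: openin_filter_space)

lemma openin_filter_space_nhd:
  "openin (filter_space F) U \<and> None \<in> U \<longleftrightarrow>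
     (\<exists>A. eventually (\<lambda>n. n \<in> A) F \<and> U = insert None (Some ` A))"
proof
  assume "openin (filter_space F) U \<and> None \<in> U"
  moreover from this have "U = insert None (Some ` (Some -` U))"
    by (auto simp: image_iff elim: option.exhaust_sel)
  ultimately show "\<exists>A. eventually (\<lambda>n. n \<in> A) F \<and> U = insert None (Some ` A)"
    unfolding openin_filter_space by blast
next
  assume "\<exists>A. eventually (\<lambda>n. n \<in> A) F \<and> U = insert None (Some ` A)"
  then show "openin (filter_space F) U \<and> None \<in> U"
    by (auto simp: openin_filter_space elim!: eventually_mono)
qed

text \<open>
  For compact \<open>K\<close>, the space \<open>C(K)\<close> is the library's type \<open>'k \<Rightarrow>\<^sub>C real\<close> of bounded
  continuous functions with the supremum norm. The library registers it as a Banach space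
  only for metric domains; the following instances remove this restriction.
\<close>

instance bcontfun :: (topological_space, complete_space) complete_space
proof
  fix f :: "nat \<Rightarrow> 'a \<Rightarrow>\<^sub>C 'b"
  assume "Cauchy f"
  then have "uniformly_Cauchy_on UNIV (\<lambda>n. apply_bcontfun (f n))"
    unfolding Cauchy_def uniformly_Cauchy_on_def by (meson dist_fun_lt_imp_dist_val_lt)
  then obtain g where "uniform_limit UNIV (\<lambda>n. apply_bcontfun (f n)) g sequentially"
    using Cauchy_uniformly_convergent uniformly_convergent_on_def by blast
  then show "convergent f"
    by (rule uniform_limit_bcontfunE) (auto intro: convergentI)
qed

instance bcontfun :: (topological_space, banach) banach ..

definition weakly_null :: "(nat \<Rightarrow> 'a::real_normed_vector) \<Rightarrow> bool" where
  "weakly_null x \<longleftrightarrow> (\<forall>\<psi> :: 'a \<Rightarrow>\<^sub>L real. (\<lambda>n. blinfun_apply \<psi> (x n)) \<longlonglongrightarrow> 0)"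

definition weak_star_null :: "(nat \<Rightarrow> ('a::real_normed_vector \<Rightarrow>\<^sub>L real)) \<Rightarrow> bool" where
  "weak_star_null \<phi> \<longleftrightarrow> (\<forall>x. (\<lambda>n. blinfun_apply (\<phi> n) x) \<longlonglongrightarrow> 0)"

definition grothendieck_space :: "'a::banach itself \<Rightarrow> bool" where
  "grothendieck_space _ \<longleftrightarrow>
     (\<forall>\<phi> :: nat \<Rightarrow> ('a \<Rightarrow>\<^sub>L real). weak_star_null \<phi> \<longrightarrow> weakly_null \<phi>)"

end

theory Submission
  imports Defs
begin

text \<open>
  The density filter turns convergence into Cesaro convergence, so if \<open>f\<close> witnesses
  \<open>F \<le>\<^sub>K \<Z>\<^sup>*\<close>, the measures \<open>(1/n) \<Sum>\<^sub>i\<^sub><\<^sub>n \<delta>\<^bsub>f i\<^esub> - \<delta>\<^bsub>p\<^esub>\<close> on the copy of \<open>N\<^sub>F\<close> inside \<open>K\<close>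
  are weak* null. They are not weakly null, because the functional \<open>\<mu> \<mapsto> \<mu> {p}\<close>, restricted to
  measures on \<open>N\<^sub>F\<close>, takes the value \<open>-1\<close> on each of them. To extend it to the whole dual of \<open>C(K)\<close>
  without the Riesz representation theorem, take Urysohn functions \<open>u\<^sub>i\<close> with \<open>u\<^sub>i(p) = 1\<close> that vanish
  at \<open>f(i)\<close>: the products \<open>h\<^sub>n = u\<^sub>0 \<cdots> u\<^sub>n\<^sub>-\<^sub>1\<close> decrease, hence form a weakly Cauchy sequence, and
  \<open>\<phi> \<mapsto> lim \<phi>(h\<^sub>n)\<close> is the required functional.
\<close>

text \<open>For every \<open>e > 0\<close> the indices where \<open>a\<close> deviates from
  \<open>l\<close> by at least \<open>e\<close> form a set of density zero. Boundedness by
  \<open>M\<close> makes their share of the mean at most \<open>M\<close> times their density below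
  \<open>n\<close>; all other indices contribute at most \<open>e\<close>.\<close>

lemma tendsto_density_filter_imp_Cesaro:
  fixes a :: "nat \<Rightarrow> real"
  assumes "(a \<longlongrightarrow> l) density_filter" and bdd: "\<And>i. \<bar>a i - l\<bar> \<le> M"
  shows "(\<lambda>n. (\<Sum>i<n. a i) / real n) \<longlonglongrightarrow> l"
proof (rule LIMSEQ_I)
  fix r :: real assume "r > 0"
  define e where "e = r / 2"
  have e: "e > 0" "e < r" using \<open>r > 0\<close> by (auto simp: e_def)
  have M: "M \<ge> 0" using bdd[of 0] by linarith
  define B where "B = {i. \<not> \<bar>a i - l\<bar> < e}"
  have "eventually (\<lambda>i. \<bar>a i - l\<bar> < e) density_filter"
    using tendstoD[OF assms(1) e(1)] by (simp add: dist_real_def)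
  then have "B \<in> density_ideal"
    by (simp add: eventually_density_filter B_def Collect_neg_eq)
  then have "(\<lambda>n. real (card (B \<inter> {0..<n})) / real n) \<longlonglongrightarrow> 0"
    by (simp add: density_ideal_iff_tendsto)
  then have "(\<lambda>n. e + M * (real (card (B \<inter> {0..<n})) / real n)) \<longlonglongrightarrow> e + M * 0"
    by (intro tendsto_intros)
  then have "\<forall>\<^sub>F n in sequentially. e + M * (real (card (B \<inter> {0..<n})) / real n) < r"
    using e(2) by (intro order_tendstoD(2)) auto
  then have "\<forall>\<^sub>F n in sequentially. norm ((\<Sum>i<n. a i) / real n - l) < r"
    using eventually_gt_at_top[of 0]
  proof eventually_elim
    case (elim n)
    have "(\<Sum>i<n. a i) / real n - l = (\<Sum>i<n. a i - l) / real n"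
      using elim(2) by (simp add: sum_subtractf field_simps)
    also have "norm \<dots> \<le> (\<Sum>i<n. \<bar>a i - l\<bar>) / real n"
      using sum_abs[of "\<lambda>i. a i - l" "{..<n}"] by (simp add: divide_right_mono)
    \<comment> \<open>Off \<open>B\<close> the term \<open>e\<close> alone suffices, and on
      \<open>B\<close> the term \<open>M\<close> does; adding both covers each index without a case
      split in the sum.\<close>
    also have "(\<Sum>i<n. \<bar>a i - l\<bar>) \<le> (\<Sum>i<n. e + M * of_bool (i \<in> B))"
      using bdd e(1) M by (intro sum_mono) (auto simp: B_def add_increasing intro: less_imp_le)
    also have "\<dots> = real n * e + M * real (card (B \<inter> {0..<n}))"
      by (simp add: sum.distrib flip: sum_distrib_left)
         (simp add: of_bool_def sum.If_cases Int_def lessThan_atLeast0 conj_commute)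
    finally show ?case
      using elim by (simp add: field_simps divide_right_mono)
  qed
  then show "\<exists>N. \<forall>n\<ge>N. norm ((\<Sum>i<n. a i) / real n - l) < r"
    by (simp add: eventually_sequentially)
qed

text \<open>The increments of a decreasing nonnegative sequence form a weakly unconditionally Cauchy
  series: whatever the signs, their signed partial sums telescope to at most \<open>h 0\<close>
  pointwise. Hence the values of \<open>\<phi>\<close> on the increments are absolutely
  summable.\<close>

lemma decseq_bcontfun_weakly_Cauchy:
  fixes h :: "nat \<Rightarrow> 'k::topological_space \<Rightarrow>\<^sub>C real" and \<phi> :: "('k \<Rightarrow>\<^sub>C real) \<Rightarrow>\<^sub>L real"
  assumes dec: "\<And>x. decseq (\<lambda>n. h n x)" and ge0: "\<And>n x. 0 \<le> h n x"
  shows "convergent (\<lambda>n. \<phi> (h n))"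
proof -
  define d where "d n = h (Suc n) - h n" for n
  \<comment> \<open>These signs turn the sum of the absolute values of \<open>\<phi> (d n)\<close>
    into the value of \<open>\<phi>\<close> at a single function.\<close>
  define s where "s n = sgn (\<phi> (d n))" for n
  have s: "\<bar>s n\<bar> \<le> 1" for n by (simp add: s_def abs_sgn_eq)
  have d: "\<bar>d n x\<bar> = h n x - h (Suc n) x" for n x
    using decseq_SucD[OF dec[of x], of n] by (simp add: d_def)
  have "(\<Sum>n<N. \<bar>\<phi> (d n)\<bar>) \<le> norm \<phi> * norm (h 0)" for N
  proof -
    have "norm (\<Sum>n<N. s n *\<^sub>R d n) \<le> norm (h 0)"
    proof (rule norm_bound)
      fix x
      have "apply_bcontfun (\<Sum>n<N. s n *\<^sub>R d n) x = (\<Sum>n<N. s n * d n x)"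
        by (induction N) auto
      also have "\<bar>\<dots>\<bar> \<le> (\<Sum>n<N. \<bar>s n\<bar> * \<bar>d n x\<bar>)"
        using sum_abs[of "\<lambda>n. s n * d n x" "{..<N}"] by (simp add: abs_mult)
      also have "\<dots> \<le> (\<Sum>n<N. h n x - h (Suc n) x)"
        unfolding d[symmetric] by (intro sum_mono mult_left_le_one_le) (use s in auto)
      also have "\<dots> = h 0 x - h N x"
        by (rule sum_lessThan_telescope')
      also have "\<dots> \<le> norm (h 0)"
        using ge0[of N x] norm_bounded[of "h 0" x] by simp
      finally show "norm (apply_bcontfun (\<Sum>n<N. s n *\<^sub>R d n) x) \<le> norm (h 0)" by simp
    qed
    then have "norm \<phi> * norm (\<Sum>n<N. s n *\<^sub>R d n) \<le> norm \<phi> * norm (h 0)"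
      by (intro mult_left_mono) auto
    moreover have "(\<Sum>n<N. \<bar>\<phi> (d n)\<bar>) = \<phi> (\<Sum>n<N. s n *\<^sub>R d n)"
      by (simp add: blinfun.sum_right blinfun.scaleR_right s_def abs_sgn mult.commute)
    ultimately show ?thesis
      using norm_blinfun[of \<phi> "\<Sum>n<N. s n *\<^sub>R d n"] by simp
  qed
  then have "summable (\<lambda>n. \<bar>\<phi> (d n)\<bar>)"
    by (intro summableI_nonneg_bounded) auto
  then have "summable (\<lambda>n. \<phi> (h (Suc n)) - \<phi> (h n))"
    using summable_rabs_cancel by (simp add: d_def blinfun.diff_right)
  then have "convergent (\<lambda>N. \<phi> (h N) - \<phi> (h 0))"
    by (simp add: summable_iff_convergent sum_lessThan_telescope[of "\<lambda>n. \<phi> (h n)"])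
  then show ?thesis
    by (simp add: convergent_diff_const_right_iff)
qed

text \<open>The functional is the weak* limit in the bidual of the canonical images of
  \<open>h n\<close>; limits preserve linearity, and the common bound \<open>M\<close> passes to the
  limit.\<close>

lemma weakly_Cauchy_imp_bidual_limit:
  fixes h :: "nat \<Rightarrow> 'a::real_normed_vector"
  assumes conv: "\<And>\<phi> :: 'a \<Rightarrow>\<^sub>L real. convergent (\<lambda>n. \<phi> (h n))" and bdd: "\<And>n. norm (h n) \<le> M"
  obtains \<psi> :: "('a \<Rightarrow>\<^sub>L real) \<Rightarrow>\<^sub>L real" where "\<And>\<phi>. (\<lambda>n. blinfun_apply \<phi> (h n)) \<longlonglongrightarrow> \<psi> \<phi>"
proof -
  define L where "L \<phi> = lim (\<lambda>n. blinfun_apply \<phi> (h n))" for \<phi> :: "'a \<Rightarrow>\<^sub>L real"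
  have L: "(\<lambda>n. blinfun_apply \<phi> (h n)) \<longlonglongrightarrow> L \<phi>" for \<phi>
    using conv[of \<phi>] by (simp add: L_def convergent_LIMSEQ_iff)
  have "bounded_linear L"
  proof (rule bounded_linear_intro[where K = M])
    show "L (\<phi> + \<theta>) = L \<phi> + L \<theta>" for \<phi> \<theta>
      using tendsto_add[OF L[of \<phi>] L[of \<theta>]] L[of "\<phi> + \<theta>"]
      by (simp add: blinfun.add_left LIMSEQ_unique)
    show "L (c *\<^sub>R \<phi>) = c *\<^sub>R L \<phi>" for c \<phi>
      using tendsto_scaleR[OF tendsto_const L[of \<phi>], of c] L[of "c *\<^sub>R \<phi>"]
      by (simp add: blinfun.scaleR_left LIMSEQ_unique)
    show "norm (L \<phi>) \<le> norm \<phi> * M" for \<phi>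
    proof (rule Lim_bounded[OF tendsto_norm[OF L]])
      show "\<forall>n\<ge>0. norm (\<phi> (h n)) \<le> norm \<phi> * M"
        using norm_blinfun[of \<phi>] bdd by (meson mult_left_mono norm_ge_zero order_trans)
    qed
  qed
  then show ?thesis
    using L by (intro that[of "Blinfun L"]) (simp add: bounded_linear_Blinfun_apply)
qed

text \<open>For real-valued functions this is the Dirac measure at the point, as an element of the
  dual.\<close>

lift_definition bcontfun_eval :: "'k::topological_space \<Rightarrow> ('k \<Rightarrow>\<^sub>C 'b::real_normed_vector) \<Rightarrow>\<^sub>L 'b"
  is "\<lambda>x g. apply_bcontfun g x"
  by (rule bounded_linear_intro[where K = 1]) (auto simp: norm_bounded)

lemma compact_Hausdorff_separating_function:
  fixes p q :: "'k::t2_space"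
  assumes "compact (UNIV :: 'k set)" "p \<noteq> q"
  obtains u :: "'k \<Rightarrow> real" where "continuous_on UNIV u" "u ` UNIV \<subseteq> {0..1}" "u p = 1" "u q = 0"
proof -
  have "Hausdorff_space (euclidean :: 'k topology)"
    unfolding Hausdorff_space_def disjnt_def using hausdorff by (simp; blast)
  then have "normal_space (euclidean :: 'k topology)"
    using assms(1) by (intro compact_Hausdorff_or_regular_imp_normal_space)
      (auto simp: compact_space_def)
  moreover have "closedin euclidean {q}" "closedin euclidean {p}" "disjnt {q} {p}"
    using assms(2) by (auto simp: disjnt_def)
  ultimately obtain u where "continuous_map euclidean (top_of_set {0..1::real}) u"
      "u ` {q} \<subseteq> {0}" "u ` {p} \<subseteq> {1}"
    using Urysohn_lemma[of euclidean "{q}" "{p}" 0 1] by auto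
  then show ?thesis
    by (intro that[of u]) (auto simp: continuous_map_in_subtopology)
qed

text \<open>On the Dirac measures at \<open>p\<close> and at the \<open>x i\<close>,
  \<open>\<psi>\<close> agrees with the functional taking a measure to its mass at
  \<open>p\<close>.\<close>

lemma bidual_point_mass:
  fixes p :: "'k::t2_space" and x :: "nat \<Rightarrow> 'k"
  assumes K: "compact (UNIV :: 'k set)" and ne: "\<And>i. x i \<noteq> p"
  obtains \<psi> :: "(('k \<Rightarrow>\<^sub>C real) \<Rightarrow>\<^sub>L real) \<Rightarrow>\<^sub>L real"
  where "\<psi> (bcontfun_eval p) = 1" "\<And>i. \<psi> (bcontfun_eval (x i)) = 0"
proof -
  have "\<exists>u :: 'k \<Rightarrow> real. continuous_on UNIV u \<and> u ` UNIV \<subseteq> {0..1} \<and> u p = 1 \<and> u (x i) = 0" for i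
    using compact_Hausdorff_separating_function[OF K ne[of i, symmetric]] by metis
  then obtain u :: "nat \<Rightarrow> 'k \<Rightarrow> real" where
    cont: "\<And>i. continuous_on UNIV (u i)" and "\<And>i. u i ` UNIV \<subseteq> {0..1}"
    and up: "\<And>i. u i p = 1" and ux: "\<And>i. u i (x i) = 0"
    by metis
  then have range: "0 \<le> u i y" "u i y \<le> 1" for i y
    by (auto simp: image_subset_iff)
  define h where "h n = Bcontfun (\<lambda>y. \<Prod>i<n. u i y)" for n
  have "(\<lambda>y. \<Prod>i<n. u i y) \<in> bcontfun" for n
    using range by (intro bcontfun_normI[where b = 1] continuous_on_prod cont)
      (auto simp: abs_prod intro!: prod_le_1)
  then have h: "h n y = (\<Prod>i<n. u i y)" for n y
    by (simp add: h_def Bcontfun_inverse)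
  have "decseq (\<lambda>n. h n y)" for y
    using range by (intro decseq_SucI) (auto simp: h intro!: mult_left_le prod_nonneg)
  moreover have "0 \<le> h n y" for n y
    using range by (auto simp: h intro!: prod_nonneg)
  moreover have "norm (h n) \<le> 1" for n
    using range by (intro norm_bound) (auto simp: h abs_prod intro!: prod_le_1)
  ultimately obtain \<psi> :: "(('k \<Rightarrow>\<^sub>C real) \<Rightarrow>\<^sub>L real) \<Rightarrow>\<^sub>L real"
    where \<psi>: "\<And>\<phi>. (\<lambda>n. blinfun_apply \<phi> (h n)) \<longlonglongrightarrow> \<psi> \<phi>"
    using weakly_Cauchy_imp_bidual_limit[of h 1] decseq_bcontfun_weakly_Cauchy[of h] by blast
  have "\<psi> (bcontfun_eval p) = 1"
    using \<psi>[of "bcontfun_eval p"] by (simp add: bcontfun_eval.rep_eq h up LIMSEQ_const_iff)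
  moreover have "\<psi> (bcontfun_eval (x i)) = 0" for i
  proof -
    \<comment> \<open>The factor \<open>u i\<close>, which vanishes at \<open>x i\<close>, occurs in
      \<open>h n\<close> exactly when \<open>n > i\<close>.\<close>
    have "\<forall>\<^sub>F n in sequentially. bcontfun_eval (x i) (h n) = 0"
      using eventually_gt_at_top[of i] by eventually_elim (use ux in \<open>auto simp: bcontfun_eval.rep_eq h\<close>)
    then show ?thesis
      by (rule LIMSEQ_unique[OF \<psi> tendsto_eventually])
  qed
  ultimately show ?thesis by (rule that)
qed

text \<open>The traces on the natural numbers of the open neighborhoods of \<open>None\<close> are
  exactly the members of \<open>F\<close>.\<close>

lemma continuous_map_filter_space_tendsto:
  assumes "continuous_map (filter_space F) euclidean g"
  shows "((\<lambda>n. g (Some n)) \<longlongrightarrow> g None) F"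
proof (rule topological_tendstoI)
  fix S assume "open S" "g None \<in> S"
  then have "openin (filter_space F) {y. g y \<in> S}"
    using assms by (auto simp: continuous_map_def topspace_filter_space)
  with \<open>g None \<in> S\<close> show "\<forall>\<^sub>F n in F. g (Some n) \<in> S"
    by (simp add: openin_filter_space)
qed

theorem corollary1p4:
  fixes F :: "nat filter"
  assumes "free_filter F"
    and "F \<le>\<^sub>K density_filter"
    and "compact (UNIV :: 'k::t2_space set)"
    and "\<exists>e :: nat option \<Rightarrow> 'k. embedding_map (filter_space F) euclidean e"
  shows "\<not> grothendieck_space TYPE('k \<Rightarrow>\<^sub>C real)"
proof
  assume G: "grothendieck_space TYPE('k \<Rightarrow>\<^sub>C real)"
  obtain e :: "nat option \<Rightarrow> 'k" where e: "embedding_map (filter_space F) euclidean e"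
    using assms(4) by blast
  have cont: "continuous_map (filter_space F) euclidean e"
    using e by (simp add: embedding_map_def homeomorphic_eq_everything_map continuous_map_in_subtopology)
  have inj: "inj e"
    using e by (simp add: embedding_map_def homeomorphic_eq_everything_map topspace_filter_space)
  obtain f where f: "filterlim f F density_filter"
    using assms(2) katetov_le_iff_filterlim by blast
  define p where "p = e None"
  define x where "x i = e (Some (f i))" for i
  \<comment> \<open>The map \<open>f\<close> may repeat values, but each \<open>x i\<close> is the
    image of an isolated point \<open>Some (f i)\<close>, never of \<open>None\<close>.\<close>
  have "x i \<noteq> p" for i
    using inj by (auto simp: x_def p_def dest: injD)
  then obtain \<psi> :: "(('k \<Rightarrow>\<^sub>C real) \<Rightarrow>\<^sub>L real) \<Rightarrow>\<^sub>L real"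
    where \<psi>: "\<psi> (bcontfun_eval p) = 1" "\<And>i. \<psi> (bcontfun_eval (x i)) = 0"
    using bidual_point_mass[OF assms(3), of x p] by blast
  \<comment> \<open>At \<open>n = 0\<close> the sum is empty, so \<open>\<phi> 0\<close> is minus
    the Dirac measure at \<open>p\<close>, and the value -1 under \<open>\<psi>\<close> holds there
    as well.\<close>
  define \<phi> :: "nat \<Rightarrow> ('k \<Rightarrow>\<^sub>C real) \<Rightarrow>\<^sub>L real"
    where "\<phi> n = (1 / real n) *\<^sub>R (\<Sum>i<n. bcontfun_eval (x i)) - bcontfun_eval p" for n
  have "weak_star_null \<phi>"
    unfolding weak_star_null_def
  proof
    fix g :: "'k \<Rightarrow>\<^sub>C real"
    have "continuous_map (filter_space F) euclidean (apply_bcontfun g \<circ> e)"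
      using cont continuous_on_apply_bcontfun[of UNIV g] by (intro continuous_map_compose) auto
    from continuous_map_filter_space_tendsto[OF this]
    have "((\<lambda>i. g (x i)) \<longlongrightarrow> g p) density_filter"
      using filterlim_compose[OF _ f] by (fastforce simp: x_def p_def)
    moreover have "\<bar>g y - g p\<bar> \<le> 2 * norm g" for y
      using norm_bounded[of g y] norm_bounded[of g p] by simp
    ultimately have "(\<lambda>n. (\<Sum>i<n. g (x i)) / real n) \<longlonglongrightarrow> g p"
      by (rule tendsto_density_filter_imp_Cesaro)
    then have "(\<lambda>n. (\<Sum>i<n. g (x i)) / real n - g p) \<longlonglongrightarrow> 0"
      by (rule LIM_zero)
    then show "(\<lambda>n. \<phi> n g) \<longlonglongrightarrow> 0"
      by (simp add: \<phi>_def blinfun.diff_left blinfun.scaleR_left blinfun.sum_left bcontfun_eval.rep_eq)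
  qed
  with G have "(\<lambda>n. \<psi> (\<phi> n)) \<longlonglongrightarrow> 0"
    unfolding grothendieck_space_def weakly_null_def by blast
  moreover have "\<psi> (\<phi> n) = -1" for n
    by (simp add: \<phi>_def blinfun.diff_right blinfun.scaleR_right blinfun.sum_right \<psi>)
  ultimately show False
    by (simp add: LIMSEQ_const_iff)
qed

end
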